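(* There exists no dextral symmetric right Leibniz algebra over $\mathbb C$ of dimension $4$ whose nilradical is isomorphic to the $3$-dimensional Leibniz algebra $\mu_2$ with basis $\{x,y,z\}$ and non-zero brackets of basis elements $[x,y]=z$, $[y,x]=-z$.
   Context: A right Leibniz algebra over a field $F$ is an $F$-vector space $L$ with a bilinear bracket $[\,,]:L\times L\to L$ satisfying $[a,[b,c]]=[[a,b],c]-[[a,c],b]$ for all $a,b,c\in L$. A Leibniz algebra $N$ is nilpotent (equivalently, right nilpotent) if $N^{<k>}=0$ for some $k\in\mathbb N$, where $N^{<1>}=N$, $N^{<n+1>}=[N^{<n>},N]$ (span of brackets). The nilradical of $L$ is its maximal nilpotent (two-sided) ideal. $L$ is dextral symmetric if for all $a,b,c\in L$, $[a,[b,c]]=0$ implies $[b,[a,c]]=0$. Brackets of basis elements not listed are zero. *)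

theory Defs
  imports "HOL-Analysis.Analysis"
begin

locale right_leibniz_algebra = vector_space scale
  for scale :: "'f::field \<Rightarrow> 'a::ab_group_add \<Rightarrow> 'a" +
  fixes bracket :: "'a \<Rightarrow> 'a \<Rightarrow> 'a"
  assumes linear_bracket_left: "Vector_Spaces.linear scale scale (\<lambda>a. bracket a b)"
    and linear_bracket_right: "Vector_Spaces.linear scale scale (\<lambda>b. bracket a b)"
    and leibniz: "bracket a (bracket b c) = bracket (bracket a b) c - bracket (bracket a c) b"
begin

definition dextral_symmetric :: bool where
  "dextral_symmetric \<longleftrightarrow>
     (\<forall>a b c. bracket a (bracket b c) = 0 \<longrightarrow> bracket b (bracket a c) = 0)"

definition two_sided_ideal :: "'a set \<Rightarrow> bool" where
  "two_sided_ideal I \<longleftrightarrow>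
     subspace I \<and> (\<forall>a\<in>I. \<forall>b. bracket a b \<in> I \<and> bracket b a \<in> I)"

text \<open>The indexing starts at 0: \<open>right_lower_central N k\<close> is $N^{<k+1>}$.\<close>

primrec right_lower_central :: "'a set \<Rightarrow> nat \<Rightarrow> 'a set" where
  "right_lower_central N 0 = N"
| "right_lower_central N (Suc k) = span {bracket a b | a b. a \<in> right_lower_central N k \<and> b \<in> N}"

definition nilpotent :: "'a set \<Rightarrow> bool" where
  "nilpotent N \<longleftrightarrow> (\<exists>k. right_lower_central N k = {0})"

text \<open>Maximality is with respect to inclusion. In finite dimension a sum of two nilpotent ideals
  is again nilpotent, so at most one subset satisfies this predicate.\<close>

definition is_nilradical :: "'a set \<Rightarrow> bool" where
  "is_nilradical N \<longleftrightarrow>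
     two_sided_ideal N \<and> nilpotent N \<and>
     (\<forall>M. two_sided_ideal M \<and> nilpotent M \<and> N \<subseteq> M \<longrightarrow> M = N)"

end

text \<open>Isomorphism between subalgebras \<open>S\<close> and \<open>T\<close> of two (possibly different) Leibniz algebras.\<close>

definition leibniz_isomorphic ::
  "('f \<Rightarrow> 'a::ab_group_add \<Rightarrow> 'a) \<Rightarrow> ('a \<Rightarrow> 'a \<Rightarrow> 'a) \<Rightarrow> 'a set \<Rightarrow>
   ('f \<Rightarrow> 'b::ab_group_add \<Rightarrow> 'b) \<Rightarrow> ('b \<Rightarrow> 'b \<Rightarrow> 'b) \<Rightarrow> 'b set \<Rightarrow> bool" where
  "leibniz_isomorphic scale1 bracket1 S scale2 bracket2 T \<longleftrightarrow>
     (\<exists>\<phi>. bij_betw \<phi> S T \<and>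
        (\<forall>a\<in>S. \<forall>b\<in>S. \<phi> (a + b) = \<phi> a + \<phi> b) \<and>
        (\<forall>c. \<forall>a\<in>S. \<phi> (scale1 c a) = scale2 c (\<phi> a)) \<and>
        (\<forall>a\<in>S. \<forall>b\<in>S. \<phi> (bracket1 a b) = bracket2 (\<phi> a) (\<phi> b)))"

text \<open>The bilinear extension of $[x,y] = z$, $[y,x] = -z$, where $x, y, z$ are the standard basis
  vectors of $\mathbb{C}^3$ in this order; see \<open>mu2_bracket_axis\<close>.\<close>

definition mu2_bracket :: "complex ^ 3 \<Rightarrow> complex ^ 3 \<Rightarrow> complex ^ 3" where
  "mu2_bracket a b = axis 3 (a $ 1 * b $ 2 - a $ 2 * b $ 1)"

lemma mu2_bracket_axis:
  "mu2_bracket (axis i 1) (axis j 1) =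
     (if i = 1 \<and> j = 2 then axis 3 1 else if i = 2 \<and> j = 1 then - axis 3 1 else 0)"
  using exhaust_3[of i] exhaust_3[of j]
  by (auto simp: mu2_bracket_def axis_def vec_eq_iff)

interpretation mu2: right_leibniz_algebra "(*s)" mu2_bracket
  by unfold_locales
     (auto simp: mu2_bracket_def axis_def vec_eq_iff algebra_simps)

end

theory Submission imports Defs begin

text \<open>Let \<open>w\<close> span a complement of the nilradical \<open>N\<close>. Since \<open>[a,[b,b]] = 0\<close> always holds, dextral
  symmetry gives \<open>[b,[a,b]] = 0\<close>, hence \<open>[b,[a,c]] = - [c,[a,b]]\<close>. Applied to \<open>x\<close>, \<open>y\<close> and \<open>w\<close>,
  this forces right multiplication by \<open>w\<close> to act on \<open>N\<close> modulo \<open>z\<close> as a scalar \<open>d\<close>, with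
  \<open>[w,z] = d z\<close> and \<open>[z,w] = 2 d z\<close>. Then \<open>0 = [w,[z,w]] = 2 d\<^sup>2 z\<close> yields \<open>d = 0\<close>, while
  \<open>[w,[w,w]] = 0\<close> yields \<open>[w,w] \<in> N\<close>. So the right lower central series of \<open>L\<close> descends through
  \<open>N\<close>, the line of \<open>z\<close>, and \<open>0\<close>: the algebra itself is nilpotent, contradicting maximality of
  \<open>N\<close>.\<close>

context right_leibniz_algebra
begin

lemma bracket_add_left: "bracket (a + b) c = bracket a c + bracket b c"
  using Vector_Spaces.linear.axioms(3)[OF linear_bracket_left] by (rule module_hom.add)

lemma bracket_add_right: "bracket c (a + b) = bracket c a + bracket c b"
  using Vector_Spaces.linear.axioms(3)[OF linear_bracket_right] by (rule module_hom.add)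

lemma bracket_scale_left: "bracket (scale r a) c = scale r (bracket a c)"
  using Vector_Spaces.linear.axioms(3)[OF linear_bracket_left] by (rule module_hom.scale)

lemma bracket_scale_right: "bracket c (scale r a) = scale r (bracket c a)"
  using Vector_Spaces.linear.axioms(3)[OF linear_bracket_right] by (rule module_hom.scale)

lemma bracket_zero_left [simp]: "bracket 0 c = 0"
  using bracket_scale_left[of 0 0 c] by simp

lemma bracket_zero_right [simp]: "bracket c 0 = 0"
  using bracket_scale_right[of c 0 0] by simp

lemma bracket_minus_left: "bracket (- a) c = - bracket a c"
  using bracket_scale_left[of "- 1" a c] by simp

lemma bracket_minus_right: "bracket c (- a) = - bracket c a"
  using bracket_scale_right[of c "- 1" a] by simp

lemmas bracket_bilinear =
  bracket_add_left bracket_add_right bracket_scale_left bracket_scale_right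
  bracket_minus_left bracket_minus_right

lemma dextral_bracket_left_repeat:
  assumes dextral_symmetric
  shows "bracket b (bracket a b) = 0"
proof -
  have "bracket a (bracket b b) = 0"
    using leibniz[of a b b] by simp
  then show ?thesis
    using assms unfolding dextral_symmetric_def by blast
qed

text \<open>Polarization: \<open>[b,[a,b]]\<close> is quadratic in \<open>b\<close> and vanishes
  identically, so expanding it at \<open>b + c\<close> leaves only the two mixed terms.\<close>

lemma dextral_bracket_swap:
  assumes dextral_symmetric
  shows "bracket b (bracket a c) = - bracket c (bracket a b)"
  using dextral_bracket_left_repeat[OF assms, of "b + c" a]
    dextral_bracket_left_repeat[OF assms, of b a] dextral_bracket_left_repeat[OF assms, of c a]
  by (simp add: bracket_bilinear eq_neg_iff_add_eq_0 add.commute)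

text \<open>Upper bounds on successive terms are enough to prove nilpotency, so the series never has
  to be computed exactly.\<close>

lemma right_lower_central_Suc_subset:
  assumes "right_lower_central N k \<subseteq> A" "subspace B"
    and "\<And>a b. a \<in> A \<Longrightarrow> b \<in> N \<Longrightarrow> bracket a b \<in> B"
  shows "right_lower_central N (Suc k) \<subseteq> B"
  unfolding right_lower_central.simps
  using assms by (intro span_minimal) auto

end

text \<open>The relations of the Heisenberg Lie algebra, imposed on three elements of an arbitrary
  ambient algebra. This way the locale covers both the model on \<open>complex ^ 3\<close> and its
  copy inside a larger algebra.\<close>

locale heisenberg_triple = right_leibniz_algebra scale bracket
  for scale :: "'f::field \<Rightarrow> 'a::ab_group_add \<Rightarrow> 'a" and bracket +
  fixes x y z :: 'a
  assumes brackets [simp]: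
      "bracket x x = 0" "bracket x y = z" "bracket x z = 0"
      "bracket y x = - z" "bracket y y = 0" "bracket y z = 0"
      "bracket z x = 0" "bracket z y = 0" "bracket z z = 0"
    and z_nonzero: "z \<noteq> 0"
begin

lemma in_span_triple_iff:
  "v \<in> span {x, y, z} \<longleftrightarrow> (\<exists>\<alpha> \<beta> \<gamma>. v = scale \<alpha> x + scale \<beta> y + scale \<gamma> z)"
proof -
  have "v \<in> span {x, y, z} \<longleftrightarrow> (\<exists>\<alpha> \<beta> \<gamma>. v - scale \<alpha> x - scale \<beta> y = scale \<gamma> z)"
    unfolding span_breakdown_eq[of v x] span_breakdown_eq[of _ y] span_singleton by blast
  then show ?thesis
    by (simp add: diff_diff_add diff_eq_eq add.commute)
qed

text \<open>Right multiplication by \<open>y\<close> kills \<open>y\<close> and \<open>z\<close> but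
  sends \<open>x\<close> to \<open>z\<close>; left multiplication by \<open>x\<close> kills
  \<open>z\<close> but sends \<open>y\<close> to \<open>z\<close>.\<close>

lemma triple_independent:
  "x \<notin> span {y, z}" "y \<notin> span {z}" "independent {x, y, z}"
proof -
  show x: "x \<notin> span {y, z}"
  proof
    assume "x \<in> span {y, z}"
    then obtain \<alpha> \<beta> where "x = scale \<alpha> y + scale \<beta> z"
      unfolding span_breakdown_eq[of x y] span_singleton by (auto simp: diff_eq_eq add.commute)
    then have "bracket x y = bracket (scale \<alpha> y + scale \<beta> z) y"
      by metis
    then have "bracket x y = 0"
      by (simp add: bracket_add_left bracket_scale_left)
    then show False
      using z_nonzero by simp
  qed
  show y: "y \<notin> span {z}"
  proof
    assume "y \<in> span {z}"
    then obtain \<beta> where "y = scale \<beta> z"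
      by (auto simp: span_singleton)
    then have "bracket x y = 0"
      by (metis bracket_scale_right brackets(3) scale_zero_right)
    then show False
      using z_nonzero by simp
  qed
  show "independent {x, y, z}"
    using x y z_nonzero by (simp add: independent_insert span_base)
qed

lemma nilpotent_of_dextral:
  assumes dextral: dextral_symmetric
    and ideal: "two_sided_ideal (span {x, y, z})"
    and notin: "w \<notin> span {x, y, z}"
    and spans: "span {w, x, y, z} = UNIV"
    and two: "(2::'f) \<noteq> 0"
  shows "nilpotent UNIV"
proof -
  let ?N = "span {x, y, z}"
  have decomp: "\<exists>g. \<exists>n\<in>?N. v = scale g w + n" for v
    using spans span_breakdown_eq[of v w "{x, y, z}"] by (metis UNIV_I add_diff_eq add_diff_cancel_left')
  have N_left: "bracket a b \<in> ?N" and N_right: "bracket b a \<in> ?N" if "a \<in> ?N" for a b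
    using ideal that unfolding two_sided_ideal_def by auto
  have in_N: "x \<in> ?N" "y \<in> ?N" "z \<in> ?N"
    by (auto intro: span_base)
  obtain a1 b1 c1 where xw: "bracket x w = scale a1 x + scale b1 y + scale c1 z"
    using N_left[OF in_N(1)] in_span_triple_iff by metis
  obtain a2 b2 c2 where yw: "bracket y w = scale a2 x + scale b2 y + scale c2 z"
    using N_left[OF in_N(2)] in_span_triple_iff by metis
  \<comment> \<open>The swap rule gives \<open>[x,[x,w]] = - [w,[x,x]] = 0\<close>, and left
    multiplication by \<open>x\<close> turns the \<open>y\<close>-coefficient of
    \<open>[x,w]\<close> into a multiple of \<open>z\<close>. The argument for \<open>a2\<close> is
    the same with \<open>x\<close> and \<open>y\<close> exchanged.\<close>
  have "scale b1 z = 0"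
    using dextral_bracket_swap[OF dextral, of x x w] by (simp add: xw bracket_bilinear)
  then have b1: "b1 = 0"
    using z_nonzero by simp
  have "scale a2 z = 0"
    using dextral_bracket_swap[OF dextral, of y y w] by (simp add: yw bracket_bilinear)
  then have a2: "a2 = 0"
    using z_nonzero by simp
  \<comment> \<open>Since \<open>z = [x,y] = - [y,x]\<close>, the swap rule evaluates
    \<open>[w,z]\<close> in two ways, through \<open>[x,[y,w]]\<close> and through
    \<open>[y,[x,w]]\<close>. Comparing them identifies the two diagonal coefficients; their common
    value \<open>b2\<close> is the scalar d of the overview.\<close>
  have wz: "bracket w z = scale b2 z"
    using dextral_bracket_swap[OF dextral, of x y w] by (simp add: yw bracket_bilinear)
  have "bracket w z = scale a1 z"
    using dextral_bracket_swap[OF dextral, of y x w] by (simp add: xw bracket_bilinear)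
  then have a1: "a1 = b2"
    using wz z_nonzero by simp
  \<comment> \<open>The Leibniz identity for \<open>[x,[y,w]]\<close>, solved for
    \<open>[[x,y],w]\<close>. Each of the two summands contributes \<open>b2\<close> times
    \<open>z\<close>.\<close>
  have "bracket z w = bracket x (bracket y w) + bracket (bracket x w) y"
    by (simp add: leibniz[of x y w])
  also have "\<dots> = scale b2 z + scale b2 z"
    by (simp add: xw yw a1 b1 a2 bracket_bilinear)
  finally have zw: "bracket z w = scale (2 * b2) z"
    by (simp only: mult_2 scale_left_distrib)
  \<comment> \<open>This is \<open>[w,[z,w]] = 0\<close>; its factor 2 is where the characteristic
    enters.\<close>
  have "scale (2 * b2 * b2) z = 0"
    using dextral_bracket_left_repeat[OF dextral, of w z] by (simp add: zw wz bracket_bilinear)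
  then have b2: "b2 = 0"
    using z_nonzero two by simp
  \<comment> \<open>Once \<open>b2 = 0\<close>, both \<open>[x,w]\<close> and \<open>[y,w]\<close>
    are multiples of \<open>z\<close> and \<open>[z,w] = 0\<close>.\<close>
  have line: "bracket n v \<in> span {z}" if n: "n \<in> ?N" for n v
  proof -
    obtain \<alpha> \<beta> \<gamma> where n: "n = scale \<alpha> x + scale \<beta> y + scale \<gamma> z"
      using n in_span_triple_iff by blast
    obtain g \<alpha>' \<beta>' \<gamma>' where v: "v = scale g w + (scale \<alpha>' x + scale \<beta>' y + scale \<gamma>' z)"
      using decomp in_span_triple_iff by metis
    show ?thesis
      unfolding n v
      by (simp add: bracket_bilinear xw yw zw a1 b1 a2 b2)
        (intro span_add span_diff span_scale span_base singletonI)
  qed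
  have z_annihilates: "bracket s v = 0" if s: "s \<in> span {z}" for s v
  proof -
    obtain \<gamma> where s: "s = scale \<gamma> z"
      using s by (auto simp: span_singleton)
    obtain g \<alpha>' \<beta>' \<gamma>' where v: "v = scale g w + (scale \<alpha>' x + scale \<beta>' y + scale \<gamma>' z)"
      using decomp in_span_triple_iff by metis
    show ?thesis
      unfolding s v by (simp add: bracket_bilinear zw b2)
  qed
  obtain g n where ww: "bracket w w = scale g w + n" and n: "n \<in> ?N"
    using decomp by blast
  \<comment> \<open>Expanding \<open>[w,[w,w]] = 0\<close> and reducing modulo the ideal leaves
    \<open>g * g\<close> times \<open>w\<close>, so a nonzero \<open>g\<close> would put
    \<open>w\<close> into the ideal.\<close>
  have "scale g (scale g w + n) + bracket w n = 0"
    using dextral_bracket_left_repeat[OF dextral, of w w] by (simp add: ww bracket_bilinear)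
  then have "scale (g * g) w = - (scale g n + bracket w n)"
    by (simp only: scale_right_distrib scale_scale eq_neg_iff_add_eq_0 add.assoc)
  also have "\<dots> \<in> ?N"
    using n N_right by (intro span_neg span_add span_scale)
  finally have "scale (inverse (g * g)) (scale (g * g) w) \<in> ?N"
    by (rule span_scale)
  then have "g = 0"
    using notin by (cases "g = 0") (auto simp del: inverse_mult_distrib)
  then have ww_in: "bracket w w \<in> ?N"
    using ww n by simp
  have derived: "bracket u v \<in> ?N" for u v
  proof -
    obtain g m where u: "u = scale g w + m" and m: "m \<in> ?N"
      using decomp by blast
    obtain h p where v: "v = scale h w + p" and p: "p \<in> ?N"
      using decomp by blast
    have "bracket u v = scale g (bracket w v) + bracket m v"
      unfolding u by (simp add: bracket_bilinear)
    moreover have "bracket w v = scale h (bracket w w) + bracket w p"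
      unfolding v by (simp add: bracket_bilinear)
    ultimately show ?thesis
      using ww_in m p N_left N_right by (simp add: span_add span_scale)
  qed
  \<comment> \<open>Indices start at 0, so the vanishing term with index 3 is the fourth one in the
    usual numbering.\<close>
  have "right_lower_central UNIV 0 \<subseteq> UNIV"
    by simp
  then have "right_lower_central UNIV (Suc 0) \<subseteq> ?N"
    by (rule right_lower_central_Suc_subset) (auto simp: derived)
  then have "right_lower_central UNIV (Suc (Suc 0)) \<subseteq> span {z}"
    by (rule right_lower_central_Suc_subset) (auto simp: line)
  then have "right_lower_central UNIV (Suc (Suc (Suc 0))) \<subseteq> {0}"
    by (rule right_lower_central_Suc_subset) (auto simp: z_annihilates)
  then have "right_lower_central UNIV (Suc (Suc (Suc 0))) = {0}"
    by (auto simp: span_zero)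
  then show ?thesis
    unfolding nilpotent_def by blast
qed

text \<open>In dimension 4 a basis extending the triple has exactly one further vector
  \<open>w\<close>. The whole algebra is then a nilpotent ideal strictly above the span, against
  maximality.\<close>

lemma span_triple_not_nilradical:
  assumes dextral: dextral_symmetric
    and dim: "dim UNIV = 4"
    and two: "(2::'f) \<noteq> 0"
  shows "\<not> is_nilradical (span {x, y, z})"
proof
  assume nilradical: "is_nilradical (span {x, y, z})"
  obtain B where B: "{x, y, z} \<subseteq> B" "independent B" "UNIV \<subseteq> span B"
    using maximal_independent_subset_extend[OF subset_UNIV triple_independent(3)] by metis
  have card_B: "card B = 4"
    using basis_card_eq_dim[of B UNIV] B dim by auto
  have "card {x, y, z} = 3"
    using triple_independent(1,2) by (auto simp: card_insert_if span_base)
  then have "card (B - {x, y, z}) = 1"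
    using B(1) card_B by (simp add: card_Diff_subset)
  then obtain w where w: "B - {x, y, z} = {w}"
    by (auto simp: card_1_singleton_iff)
  then have B_eq: "B = {w, x, y, z}" and w_new: "w \<notin> {x, y, z}"
    using B(1) by auto
  have notin: "w \<notin> span {x, y, z}"
    using B(2) w_new unfolding B_eq by (simp add: independent_insert)
  have "nilpotent UNIV"
    using nilradical dextral notin B(3) two unfolding B_eq is_nilradical_def
    by (intro nilpotent_of_dextral) auto
  moreover have "two_sided_ideal UNIV"
    by (simp add: two_sided_ideal_def)
  ultimately have "UNIV = span {x, y, z}"
    using nilradical unfolding is_nilradical_def by blast
  then show False
    using notin by blast
qed

end

text \<open>Replaces the abstract isomorphism by concrete elements of \<open>N\<close>, namely the
  preimages of the triple, so that the rest of the argument can compute inside one algebra.\<close>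

lemma (in right_leibniz_algebra) heisenberg_triple_of_isomorphic:
  fixes scale' :: "'f \<Rightarrow> 'b::ab_group_add \<Rightarrow> 'b"
  assumes N: "subspace N"
    and closed: "\<And>a b. a \<in> N \<Longrightarrow> b \<in> N \<Longrightarrow> bracket a b \<in> N"
    and iso: "leibniz_isomorphic scale bracket N scale' bracket' UNIV"
    and triple: "heisenberg_triple scale' bracket' x y z"
    and spans: "module.span scale' {x, y, z} = UNIV"
  shows "\<exists>x' y' z'. heisenberg_triple scale bracket x' y' z' \<and> N = span {x', y', z'}"
proof -
  interpret target: heisenberg_triple scale' bracket' x y z
    by (rule triple)
  obtain \<phi> where bij: "bij_betw \<phi> N UNIV"
    and add: "\<And>a b. a \<in> N \<Longrightarrow> b \<in> N \<Longrightarrow> \<phi> (a + b) = \<phi> a + \<phi> b"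
    and scale: "\<And>c a. a \<in> N \<Longrightarrow> \<phi> (scale c a) = scale' c (\<phi> a)"
    and br: "\<And>a b. a \<in> N \<Longrightarrow> b \<in> N \<Longrightarrow> \<phi> (bracket a b) = bracket' (\<phi> a) (\<phi> b)"
    using iso unfolding leibniz_isomorphic_def by blast
  have inj: "a = b" if "a \<in> N" "b \<in> N" "\<phi> a = \<phi> b" for a b
    using bij that unfolding bij_betw_def inj_on_def by blast
  have zero_in: "0 \<in> N"
    using N by (rule subspace_0)
  have \<phi>0: "\<phi> 0 = 0"
    using scale[OF zero_in, of 0] by simp
  have neg_in: "- a \<in> N" if "a \<in> N" for a
    using N that by (rule subspace_neg)
  have neg: "\<phi> (- a) = - \<phi> a" if "a \<in> N" for a
    using scale[OF that, of "- 1"] by simp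
  have "\<exists>a\<in>N. \<phi> a = v" for v
    using bij unfolding bij_betw_def by (metis UNIV_I imageE)
  then obtain x' y' z' where in_N: "x' \<in> N" "y' \<in> N" "z' \<in> N"
    and images: "\<phi> x' = x" "\<phi> y' = y" "\<phi> z' = z"
    by metis
  have "heisenberg_triple scale bracket x' y' z'"
  proof
    show "z' \<noteq> 0"
      using images \<phi>0 target.z_nonzero by auto
  \<comment> \<open>Both sides of each relation lie in \<open>N\<close> and have the same image, so
    injectivity on \<open>N\<close> equates them.\<close>
  qed (rule inj; simp add: in_N zero_in neg_in closed br images \<phi>0 neg)+
  moreover have "span {x', y', z'} \<subseteq> N"
    using in_N N by (intro span_minimal) auto
  moreover have "N \<subseteq> span {x', y', z'}"
  proof
    fix a assume a: "a \<in> N"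
    obtain \<alpha> \<beta> \<gamma> where "\<phi> a = scale' \<alpha> x + scale' \<beta> y + scale' \<gamma> z"
      using spans target.in_span_triple_iff[of "\<phi> a"] by auto
    then have "a = scale \<alpha> x' + scale \<beta> y' + scale \<gamma> z'"
      using a in_N by (intro inj) (simp_all add: add scale images subspace_add[OF N] subspace_scale[OF N])
    then show "a \<in> span {x', y', z'}"
      by (simp add: span_add span_scale span_base)
  qed
  ultimately show ?thesis
    by blast
qed

lemma mu2_heisenberg_triple:
  "heisenberg_triple (*s) mu2_bracket (axis 1 1) (axis 2 1) (axis 3 1)"
  by unfold_locales (simp_all add: mu2_bracket_axis)

lemma mu2_span_triple: "vec.span {axis 1 1, axis 2 1, axis 3 1 :: complex ^ 3} = UNIV"
proof -
  have "(cart_basis :: (complex ^ 3) set) = (\<lambda>i. axis i 1) ` UNIV"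
    unfolding cart_basis_def by auto
  then have "(cart_basis :: (complex ^ 3) set) = {axis 1 1, axis 2 1, axis 3 1}"
    by (simp add: UNIV_3)
  then show ?thesis
    using span_cart_basis by metis
qed

theorem proposition5p6:
  "\<not> (\<exists>(scale :: complex \<Rightarrow> 'a::ab_group_add \<Rightarrow> 'a) bracket N.
        right_leibniz_algebra scale bracket \<and>
        right_leibniz_algebra.dextral_symmetric bracket \<and>
        vector_space.dim scale UNIV = 4 \<and>
        right_leibniz_algebra.is_nilradical scale bracket N \<and>
        leibniz_isomorphic scale bracket N (*s) mu2_bracket UNIV)"
proof
  assume "\<exists>(scale :: complex \<Rightarrow> 'a \<Rightarrow> 'a) bracket N.
        right_leibniz_algebra scale bracket \<and>
        right_leibniz_algebra.dextral_symmetric bracket \<and>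
        vector_space.dim scale UNIV = 4 \<and>
        right_leibniz_algebra.is_nilradical scale bracket N \<and>
        leibniz_isomorphic scale bracket N (*s) mu2_bracket UNIV"
  then obtain scale :: "complex \<Rightarrow> 'a \<Rightarrow> 'a" and bracket N
    where alg: "right_leibniz_algebra scale bracket"
      and dextral: "right_leibniz_algebra.dextral_symmetric bracket"
      and dim: "vector_space.dim scale UNIV = 4"
      and nilradical: "right_leibniz_algebra.is_nilradical scale bracket N"
      and iso: "leibniz_isomorphic scale bracket N (*s) mu2_bracket UNIV"
    by blast
  interpret L: right_leibniz_algebra scale bracket
    by (rule alg)
  have "L.two_sided_ideal N"
    using nilradical by (simp add: L.is_nilradical_def)
  then obtain x y z where triple: "heisenberg_triple scale bracket x y z"
    and N: "N = L.span {x, y, z}"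
    using L.heisenberg_triple_of_isomorphic[OF _ _ iso mu2_heisenberg_triple mu2_span_triple]
    unfolding L.two_sided_ideal_def by blast
  show False
    using heisenberg_triple.span_triple_not_nilradical[OF triple dextral dim] nilradical N by simp
qed

end
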